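(* $\mathrm{ELDL}\subseteq k\mathrm{STAT}$ and $\mathrm{ELDL}_{\mathrm{poly}}\subseteq k\mathrm{STAT}_{\mathrm{poly}}$.
   Context: All classes are classes of families of Boolean functions on $\{0,1\}^n$; "polynomial" means polynomial in $n$. An exact threshold function is $\mathbf{1}[\langle\mathbf{w},\mathbf{x}\rangle=\theta]$. An exact linear decision list (ELDL) is a sequence of instructions "if $f_i(\mathbf{x})=1$ then output $c_i$" ($i=1,\dots,m$) followed by "output 0", where each $f_i$ is an exact threshold function and $c_i\in\{0,1\}$; its length is $m$ and its maximum weight is the largest coefficient of any $f_i$. $\mathrm{ELDL}$: polynomial length; $\mathrm{ELDL}_{\mathrm{poly}}$: polynomial length and polynomially bounded maximum weight. For a vector $\mathbf{z}$, $\mathbf{z}_{(k)}$ denotes its $k$-th smallest entry. $k\mathrm{STAT}$ is the class of functions $f$ for which there exist linear forms (affine functions) with integer coefficients $L_1,\dots,L_{\ell_1},R_1,\dots,R_{\ell_2}$, $\ell_1+\ell_2$ polynomial in $n$, and integers $k_l,k_r$, such that $f(\mathbf{x})=1\iff(L_1(\mathbf{x}),\dots,L_{\ell_1}(\mathbf{x}))_{(k_l)}<(R_1(\mathbf{x}),\dots,R_{\ell_2}(\mathbf{x}))_{(k_r)}$; $k\mathrm{STAT}_{\mathrm{poly}}$ is the subclass with all coefficients bounded in absolute value by a polynomial in $n$. *)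

theory Defs
  imports Complex_Main "HOL-Computational_Algebra.Polynomial"
begin

text \<open>
  A point of $\{0,1\}^n$ is a Boolean list of length $n$.  A family of Boolean functions, with one
  function for each $n$, is a single function on all Boolean lists: its $n$-th member is the
  restriction to lists of length $n$.
\<close>

type_synonym bool_family = "bool list \<Rightarrow> bool"

definition inner_prod :: "'a::comm_semiring_1 list \<Rightarrow> bool list \<Rightarrow> 'a" where
  "inner_prod w x = (\<Sum>i<length x. w ! i * of_bool (x ! i))"

text \<open>A pair \<open>(w, \<theta>)\<close> of weights and threshold.\<close>

type_synonym exact_threshold = "real list \<times> real"

fun et_eval :: "exact_threshold \<Rightarrow> bool list \<Rightarrow> bool" where
  "et_eval (w, \<theta>) x \<longleftrightarrow> inner_prod w x = \<theta>"

text \<open>The final instruction ``output 0'' is implicit, so the length of the list is $m$.\<close>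

type_synonym eldl = "(exact_threshold \<times> bool) list"

fun eldl_eval :: "eldl \<Rightarrow> bool list \<Rightarrow> bool" where
  "eldl_eval [] x = False"
| "eldl_eval ((f, c) # d) x = (if et_eval f x then c else eldl_eval d x)"

definition eldl_computes :: "nat \<Rightarrow> eldl \<Rightarrow> bool_family \<Rightarrow> bool" where
  "eldl_computes n d f \<longleftrightarrow>
     (\<forall>((w, \<theta>), c) \<in> set d. length w = n) \<and>
     (\<forall>x. length x = n \<longrightarrow> f x = eldl_eval d x)"

definition eldl_integral :: "eldl \<Rightarrow> bool" where
  "eldl_integral d \<longleftrightarrow> (\<forall>((w, \<theta>), c) \<in> set d. set w \<subseteq> \<int>)"

text \<open>The inserted 0 only matters when there is no coefficient at all.\<close>

definition eldl_max_weight :: "eldl \<Rightarrow> real" where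
  "eldl_max_weight d = Max (insert 0 (\<Union>((w, \<theta>), c) \<in> set d. abs ` set w))"

definition ELDL :: "bool_family set" where
  "ELDL = {f. \<exists>p :: nat poly. \<forall>n. \<exists>d. eldl_computes n d f \<and> length d \<le> poly p n}"

text \<open>
  A bound on the maximum weight is only meaningful for integer weights, because rescaling an exact
  threshold function makes real weights arbitrarily small.  The thresholds are left unrestricted.
  This does not enlarge the class: if the weights are integers bounded by $W$, then a threshold that
  is not an integer or exceeds $n W$ in absolute value is never attained, and $n W + 1$ can be
  used in its place.
\<close>

definition ELDL_poly :: "bool_family set" where
  "ELDL_poly =
     {f. \<exists>p q :: nat poly. \<forall>n. \<exists>d. eldl_computes n d f \<and> length d \<le> poly p n \<and>
           eldl_integral d \<and> eldl_max_weight d \<le> real (poly q n)}"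

text \<open>The pair \<open>(a, b)\<close> stands for the affine function with linear part \<open>a\<close> and constant term \<open>b\<close>.\<close>

type_synonym affine_form = "int list \<times> int"

fun affine_eval :: "affine_form \<Rightarrow> bool list \<Rightarrow> int" where
  "affine_eval (a, b) x = inner_prod a x + b"

text \<open>Entries are counted with multiplicity and from 1; meaningful for \<open>1 \<le> k \<le> length z\<close>.\<close>

definition kth_smallest :: "nat \<Rightarrow> 'a::linorder list \<Rightarrow> 'a" where
  "kth_smallest k z = sort z ! (k - 1)"

definition kstat_computes ::
  "nat \<Rightarrow> affine_form list \<Rightarrow> affine_form list \<Rightarrow> nat \<Rightarrow> nat \<Rightarrow> bool_family \<Rightarrow> bool" where
  "kstat_computes n L R kl kr f \<longleftrightarrow>
     (\<forall>(a, b) \<in> set L \<union> set R. length a = n) \<and>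
     kl \<in> {1..length L} \<and> kr \<in> {1..length R} \<and>
     (\<forall>x. length x = n \<longrightarrow>
        (f x \<longleftrightarrow> kth_smallest kl (map (\<lambda>l. affine_eval l x) L)
              < kth_smallest kr (map (\<lambda>r. affine_eval r x) R)))"

definition kSTAT :: "bool_family set" where
  "kSTAT =
     {f. \<exists>p :: nat poly. \<forall>n. \<exists>L R kl kr.
           kstat_computes n L R kl kr f \<and> length L + length R \<le> poly p n}"

definition kSTAT_poly :: "bool_family set" where
  "kSTAT_poly =
     {f. \<exists>p q :: nat poly. \<forall>n. \<exists>L R kl kr.
           kstat_computes n L R kl kr f \<and> length L + length R \<le> poly p n \<and>
           (\<forall>(a, b) \<in> set L \<union> set R. \<forall>c \<in> insert b (set a). \<bar>c\<bar> \<le> int (poly q n))}"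

end

theory Submission
  imports Defs "HOL-Analysis.Kronecker_Approximation_Theorem"
begin

text \<open>
  Replace each test \<open>g\<^sub>i(x) = 0\<close> by the two forms \<open>M g\<^sub>i + o\<^sub>i\<close> and \<open>B - M g\<^sub>i\<close>, where
  \<open>0 \<le> o\<^sub>i < B < M\<close>.  If \<open>g\<^sub>i(x) \<noteq> 0\<close>, one of them is negative and the other is at least \<open>B\<close>; if
  \<open>g\<^sub>i(x) = 0\<close>, they are \<open>o\<^sub>i\<close> and \<open>B\<close>.  So each of the \<open>m\<close> tests contributes exactly one entry
  below \<open>B\<close>, and the \<open>m\<close>-th smallest of the \<open>2m\<close> entries is the largest \<open>o\<^sub>i\<close> among the tests that
  fire.  With decreasing offsets this is the offset of the first such test.  Using the offsets
  \<open>2(m - i)\<close> on the left and \<open>2(m - i) + c\<^sub>i\<close> on the right, the comparison of the two order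
  statistics returns the output \<open>c\<^sub>i\<close> of that test.  Real weights are first made integral by
  simultaneous Diophantine approximation, which preserves the zero set on the cube.
\<close>

section \<open>Order statistics by counting\<close>

text \<open>Sorting preserves both counts. In the sorted list the entries below \<open>v\<close> and
  the entries at most \<open>v\<close> form initial segments, and position \<open>k - 1\<close> lies
  beyond the first and within the second. Later arguments only need to count.\<close>

lemma kth_smallest_eqI:
  assumes less: "length (filter (\<lambda>y. y < v) z) < k" and le: "k \<le> length (filter (\<lambda>y. y \<le> v) z)"
  shows "kth_smallest k z = v"
proof -
  define s where "s = sort z"
  have s: "sorted s" "length s = length z"
    by (simp_all add: s_def)
  have filt: "length (filter P z) = card {i. i < length s \<and> P (s ! i)}" for P
  proof -
    have "length (filter P z) = length (filter P s)"
      by (simp add: s_def filter_sort)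
    then show ?thesis
      by (simp add: length_filter_conv_card)
  qed
  have k: "0 < k" "k \<le> length s"
    using less le length_filter_le[of "\<lambda>y. y \<le> v" z] s(2) by linarith+
  have "\<not> s ! (k - 1) < v"
  proof
    assume "s ! (k - 1) < v"
    have "{..<k} \<subseteq> {i. i < length s \<and> s ! i < v}"
    proof
      fix i assume "i \<in> {..<k}"
      then have "s ! i \<le> s ! (k - 1)" "i < length s"
        using k by (auto intro!: sorted_nth_mono[OF s(1)])
      with \<open>s ! (k - 1) < v\<close> show "i \<in> {i. i < length s \<and> s ! i < v}"
        by auto
    qed
    from card_mono[OF _ this] show False
      using less by (simp add: filt)
  qed
  moreover have "\<not> v < s ! (k - 1)"
  proof
    assume gt: "v < s ! (k - 1)"
    have "{i. i < length s \<and> s ! i \<le> v} \<subseteq> {..<k - 1}"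
    proof
      fix i assume "i \<in> {i. i < length s \<and> s ! i \<le> v}"
      then have "\<not> k - 1 \<le> i"
        using gt sorted_nth_mono[OF s(1), of "k - 1" i] by auto
      then show "i \<in> {..<k - 1}"
        by simp
    qed
    from card_mono[OF _ this] show False
      using le k by (simp add: filt)
  qed
  ultimately show ?thesis
    by (simp add: kth_smallest_def s_def)
qed

text \<open>Each of the \<open>m\<close> pairs has exactly one entry at most \<open>t j\<close>, so
  \<open>m\<close> entries are at most \<open>t j\<close>. No pair has two entries below
  \<open>t j\<close>, and pair \<open>j\<close> has none, so fewer than \<open>m\<close> entries are
  below \<open>t j\<close>.\<close>

lemma kth_smallest_first_zero:
  fixes g t :: "nat \<Rightarrow> int"
  assumes j: "j < m" "g j = 0" "\<And>i. i < j \<Longrightarrow> g i \<noteq> 0"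
    and t: "\<And>i. i < m \<Longrightarrow> 0 \<le> t i" "\<And>i. i < m \<Longrightarrow> t i < B"
    and decreasing: "\<And>i i'. i < i' \<Longrightarrow> i' < m \<Longrightarrow> t i' < t i"
  shows "kth_smallest m (map (\<lambda>i. (B + 1) * g i + t i) [0..<m] @
                         map (\<lambda>i. - (B + 1) * g i + B) [0..<m]) = t j"
    (is "kth_smallest m (map ?a _ @ map ?b _) = _")
proof (rule kth_smallest_eqI)
  have B: "B > 0"
    using t j(1) by fastforce
  have pos: "(B + 1) * g i \<ge> B + 1" if "g i > 0" for i
    using that B mult_left_mono[of 1 "g i" "B + 1"] by simp
  have neg: "(B + 1) * g i \<le> - (B + 1)" if "g i < 0" for i
    using that B mult_left_mono[of "g i" "-1" "B + 1"] by simp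
  have a_pos: "?a i \<ge> B" "?b i < 0" if "g i > 0" "i < m" for i
    using pos[OF that(1)] t(1)[OF that(2)] by linarith+
  have a_neg: "?a i < 0" "?b i \<ge> B" if "g i < 0" "i < m" for i
    using neg[OF that(1)] t(2)[OF that(2)] B by linarith+
  have le_j: "t i \<le> t j" if "g i = 0" "i < m" for i
    using that j decreasing[of j i] by (cases i j rule: linorder_cases) force+
  have count: "length (filter P (map ?a [0..<m] @ map ?b [0..<m])) =
      card {i \<in> {..<m}. P (?a i)} + card {i \<in> {..<m}. P (?b i)}" for P
  proof -
    have "length (filter P (map h [0..<m])) = card {i \<in> {..<m}. P (h i)}" for h :: "nat \<Rightarrow> int"
      by (simp add: length_filter_conv_card) (rule arg_cong[of _ _ card], auto)
    then show ?thesis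
      by simp
  qed
  have tj: "0 \<le> t j" "t j < B"
    using t j(1) by auto
  \<comment> \<open>If \<open>g i = 0\<close>, the pair is \<open>t i\<close> and \<open>B\<close>,
    with \<open>t i \<le> t j\<close> because \<open>j\<close> is the first zero and the offsets
    decrease. Otherwise one entry is negative and the other at least \<open>B\<close>.\<close>
  have small: "?a i \<le> t j \<longleftrightarrow> \<not> ?b i \<le> t j" if "i < m" for i
    using a_pos[of i] a_neg[of i] le_j[of i] that tj
    by (cases "g i" "0 :: int" rule: linorder_cases) auto
  have "card {..<m} = card ({i \<in> {..<m}. ?a i \<le> t j} \<union> {i \<in> {..<m}. ?b i \<le> t j})"
    using small by (intro arg_cong[of _ _ card]) blast
  also have "\<dots> \<le> card {i \<in> {..<m}. ?a i \<le> t j} + card {i \<in> {..<m}. ?b i \<le> t j}"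
    by (rule card_Un_le)
  finally show "m \<le> length (filter (\<lambda>y. y \<le> t j) (map ?a [0..<m] @ map ?b [0..<m]))"
    unfolding count by simp
  have "card {i \<in> {..<m}. ?a i < t j} + card {i \<in> {..<m}. ?b i < t j} =
      card ({i \<in> {..<m}. ?a i < t j} \<union> {i \<in> {..<m}. ?b i < t j})"
    using small by (intro card_Un_disjoint[symmetric]) fastforce+
  also have "\<dots> < card {..<m}"
  proof (rule psubset_card_mono)
    have "j \<in> {..<m} - ({i \<in> {..<m}. ?a i < t j} \<union> {i \<in> {..<m}. ?b i < t j})"
      using j tj by simp
    then show "{i \<in> {..<m}. ?a i < t j} \<union> {i \<in> {..<m}. ?b i < t j} \<subset> {..<m}"
      by blast
  qed simp
  finally show "length (filter (\<lambda>y. y < t j) (map ?a [0..<m] @ map ?b [0..<m])) < m"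
    unfolding count by simp
qed

section \<open>Affine forms for the pairs and their coefficients\<close>

fun affine_comp :: "int \<Rightarrow> int \<Rightarrow> affine_form \<Rightarrow> affine_form" where
  "affine_comp c s (a, b) = (map ((*) c) a, c * b + s)"

lemma affine_eval_affine_comp:
  assumes "length (fst f) = length x"
  shows "affine_eval (affine_comp c s f) x = c * affine_eval f x + s"
  using assms
  by (cases f) (simp add: Defs.inner_prod_def sum_distrib_left algebra_simps
      del: sum_mult_of_bool_eq)

lemma length_affine_comp [simp]: "length (fst (affine_comp c s f)) = length (fst f)"
  by (cases f) simp

definition coeffs_le :: "int \<Rightarrow> affine_form \<Rightarrow> bool" where
  "coeffs_le C f \<longleftrightarrow> (\<forall>c \<in> insert (snd f) (set (fst f)). \<bar>c\<bar> \<le> C)"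

lemma coeffs_le_affine_comp:
  assumes "coeffs_le C f" "\<bar>c\<bar> \<le> D" "\<bar>s\<bar> \<le> D"
  shows "coeffs_le (D * C + D) (affine_comp c s f)"
proof -
  have mult: "\<bar>c * u\<bar> \<le> D * C" if "\<bar>u\<bar> \<le> C" for u
    using that assms(2) by (simp add: abs_mult mult_mono)
  have "D \<ge> 0"
    using assms(2) by simp
  obtain a b where f: "f = (a, b)"
    by fastforce
  have "\<bar>c * b + s\<bar> \<le> D * C + D"
    using mult[of b] assms(1,3) by (simp add: coeffs_le_def f)
  moreover have "\<bar>c * u\<bar> \<le> D * C + D" if "u \<in> set a" for u
    using mult[of u] assms(1) that \<open>D \<ge> 0\<close> by (auto simp: coeffs_le_def f)
  ultimately show ?thesis
    by (auto simp: coeffs_le_def f)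
qed

text \<open>The multiplier \<open>B + 1\<close> is the least integer above \<open>B\<close>. Since
  the forms take integer values, it already pushes one entry of a pair below 0 whenever the test
  fails.\<close>

definition selector_forms :: "nat \<Rightarrow> (nat \<Rightarrow> affine_form) \<Rightarrow> (nat \<Rightarrow> int) \<Rightarrow> int \<Rightarrow> affine_form list" where
  "selector_forms m F t B = map (\<lambda>i. affine_comp (B + 1) (t i) (F i)) [0..<m] @
                            map (\<lambda>i. affine_comp (- (B + 1)) B (F i)) [0..<m]"

lemma length_selector_forms [simp]: "length (selector_forms m F t B) = 2 * m"
  by (simp add: selector_forms_def)

lemma length_in_selector_forms:
  assumes "\<And>i. i < m \<Longrightarrow> length (fst (F i)) = n" "f \<in> set (selector_forms m F t B)"
  shows "length (fst f) = n"
  using assms by (auto simp: selector_forms_def)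

lemma coeffs_le_selector_forms:
  assumes "\<And>i. i < m \<Longrightarrow> coeffs_le C (F i)" "\<And>i. i < m \<Longrightarrow> 0 \<le> t i" "\<And>i. i < m \<Longrightarrow> t i < B"
    and "f \<in> set (selector_forms m F t B)"
  shows "coeffs_le ((B + 1) * C + (B + 1)) f"
proof -
  obtain i where i: "i < m"
    and f: "f = affine_comp (B + 1) (t i) (F i) \<or> f = affine_comp (- (B + 1)) B (F i)"
    using assms(4) by (auto simp: selector_forms_def)
  with assms(2,3)[OF i] coeffs_le_affine_comp[OF assms(1)[OF i]] show ?thesis
    by fastforce
qed

lemma kth_smallest_selector_forms:
  assumes "\<And>i. i < m \<Longrightarrow> length (fst (F i)) = length x"
    and "j < m" "affine_eval (F j) x = 0" "\<And>i. i < j \<Longrightarrow> affine_eval (F i) x \<noteq> 0"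
    and "\<And>i. i < m \<Longrightarrow> 0 \<le> t i" "\<And>i. i < m \<Longrightarrow> t i < B"
    and "\<And>i i'. i < i' \<Longrightarrow> i' < m \<Longrightarrow> t i' < t i"
  shows "kth_smallest m (map (\<lambda>f. affine_eval f x) (selector_forms m F t B)) = t j"
proof -
  have "map (\<lambda>f. affine_eval f x) (selector_forms m F t B) =
      map (\<lambda>i. (B + 1) * affine_eval (F i) x + t i) [0..<m] @
      map (\<lambda>i. - (B + 1) * affine_eval (F i) x + B) [0..<m]"
    unfolding selector_forms_def map_append map_map
    by (intro arg_cong2[of _ _ _ _ "(@)"] map_cong refl)
      (simp_all only: comp_apply affine_eval_affine_comp assms(1) set_upt atLeastLessThan_iff)
  then show ?thesis
    using kth_smallest_first_zero[of j m "\<lambda>i. affine_eval (F i) x" t B] assms by simp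
qed

section \<open>From decision lists to order statistics\<close>

lemma eldl_eval_first:
  assumes "j < length d" "et_eval (fst (d ! j)) x" "\<And>i. i < j \<Longrightarrow> \<not> et_eval (fst (d ! i)) x"
  shows "eldl_eval d x = snd (d ! j)"
  using assms
proof (induction d arbitrary: j)
  case (Cons r d)
  obtain f c where r: "r = (f, c)"
    by fastforce
  show ?case
  proof (cases j)
    case 0
    with Cons.prems r show ?thesis by simp
  next
    case (Suc j')
    have "\<not> et_eval f x"
      using Cons.prems(3)[of 0] Suc r by simp
    moreover have "eldl_eval d x = snd (d ! j')"
      using Cons.prems(1,2) Cons.prems(3)[of "Suc _"] Suc by (intro Cons.IH) auto
    ultimately show ?thesis
      using Suc r by simp
  qed
qed simp

lemma eldl_eval_none:
  assumes "\<And>i. i < length d \<Longrightarrow> \<not> et_eval (fst (d ! i)) x"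
  shows "\<not> eldl_eval d x"
  using assms
proof (induction d)
  case (Cons r d)
  obtain f c where r: "r = (f, c)"
    by fastforce
  show ?case
    using Cons.IH Cons.prems[of 0] Cons.prems[of "Suc _"] r by auto
qed simp

text \<open>A test matters only through its zero set on the cube. Both inclusions share one
  construction and differ only in how they find such integer forms.\<close>

definition same_zeros :: "nat \<Rightarrow> exact_threshold \<Rightarrow> affine_form \<Rightarrow> bool" where
  "same_zeros n h f \<longleftrightarrow>
     length (fst f) = n \<and> (\<forall>x. length x = n \<longrightarrow> (et_eval h x \<longleftrightarrow> affine_eval f x = 0))"

text \<open>The final ``output 0'' becomes an additional test \<open>0 = 0\<close>, so that some test always fires.\<close>

lemma kstat_computes_of_eldl:
  assumes d: "eldl_computes n d f"
    and F: "\<And>i. i < length d \<Longrightarrow> same_zeros n (fst (d ! i)) (F i)"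
    and C: "0 \<le> C" "\<And>i. i < length d \<Longrightarrow> coeffs_le C (F i)"
  obtains L R k where "kstat_computes n L R k k f" "length L + length R = 4 * (length d + 1)"
    "\<And>h. h \<in> set L \<union> set R \<Longrightarrow> coeffs_le ((2 * int (length d) + 5) * (C + 1)) h"
proof -
  define l where "l = length d"
  define m where "m = l + 1"
  define G where "G i = (if i < l then F i else (replicate n 0, 0))" for i
  define c where "c i = (if i < l then snd (d ! i) else False)" for i
  \<comment> \<open>Steps of 2 leave room for the output bit: \<open>u\<close> still decreases
    strictly.\<close>
  define t where "t i = 2 * (int m - int i)" for i
  define u where "u i = t i + of_bool (c i)" for i
  \<comment> \<open>The largest possible offset is \<open>u 0 = 2 * m + 1\<close>.\<close>
  define B where "B = 2 * int m + 2"
  define L where "L = selector_forms m G t B"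
  define R where "R = selector_forms m G u B"
  have len: "length (fst (G i)) = n" if "i < m" for i
    using F[of i] that by (auto simp: G_def l_def same_zeros_def)
  have coeff: "coeffs_le C (G i)" if "i < m" for i
    using C that by (auto simp: G_def l_def coeffs_le_def)
  have t: "0 \<le> t i" "t i < B" if "i < m" for i
    using that by (auto simp: t_def B_def)
  have u: "0 \<le> u i" "u i < B" if "i < m" for i
    using that by (auto simp: u_def t_def B_def)
  have t_dec: "t i' < t i" if "i < i'" for i i'
    using that by (simp add: t_def)
  have u_dec: "u i' < u i" if "i < i'" for i i'
    using that by (auto simp: u_def t_def)
  have eval: "f x \<longleftrightarrow> kth_smallest m (map (\<lambda>f. affine_eval f x) L)
                  < kth_smallest m (map (\<lambda>f. affine_eval f x) R)" if x: "length x = n" for x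
  proof -
    define j where "j = (LEAST i. affine_eval (G i) x = 0)"
    have last: "affine_eval (G l) x = 0"
      using x by (simp add: G_def Defs.inner_prod_def)
    have j: "affine_eval (G j) x = 0" "j \<le> l"
      unfolding j_def
      using LeastI[of "\<lambda>i. affine_eval (G i) x = 0", OF last]
        Least_le[of "\<lambda>i. affine_eval (G i) x = 0", OF last] by simp_all
    have before_j: "affine_eval (G i) x \<noteq> 0" if "i < j" for i
      using not_less_Least[of i "\<lambda>i. affine_eval (G i) x = 0"] that by (simp add: j_def)
    have et: "et_eval (fst (d ! i)) x \<longleftrightarrow> affine_eval (G i) x = 0" if "i < l" for i
      using F[of i] that x by (simp add: same_zeros_def G_def l_def)
    have "eldl_eval d x = c j"
    proof (cases "j < l")
      case True
      then show ?thesis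
        using eldl_eval_first[of j d x] et j before_j by (auto simp: l_def c_def)
    next
      \<comment> \<open>Here \<open>j = l\<close> is the added test, and \<open>c l = False\<close>
        agrees with the implicit final output.\<close>
      case False
      then show ?thesis
        using eldl_eval_none[of d x] et j before_j by (auto simp: l_def c_def)
    qed
    then have "f x = c j"
      using d x by (simp add: eldl_computes_def)
    moreover have "kth_smallest m (map (\<lambda>f. affine_eval f x) L) = t j"
      unfolding L_def using len x j before_j t t_dec by (intro kth_smallest_selector_forms) (auto simp: m_def)
    moreover have "kth_smallest m (map (\<lambda>f. affine_eval f x) R) = u j"
      unfolding R_def using len x j before_j u u_dec by (intro kth_smallest_selector_forms) (auto simp: m_def)
    \<comment> \<open>The two order statistics differ by \<open>of_bool (c j)\<close>, so the
      inequality is strict exactly when \<open>c j\<close> holds.\<close>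
    ultimately show ?thesis
      by (simp add: u_def)
  qed
  show ?thesis
  proof
    have "length (fst h) = n" if "h \<in> set L \<union> set R" for h
      using that len length_in_selector_forms unfolding L_def R_def by blast
    then have "\<forall>(a, b) \<in> set L \<union> set R. length a = n"
      by fastforce
    moreover have "m \<in> {1..length L}" "m \<in> {1..length R}"
      by (simp_all add: m_def L_def R_def)
    ultimately show "kstat_computes n L R m m f"
      unfolding kstat_computes_def using eval by blast
    show "length L + length R = 4 * (length d + 1)"
      by (simp add: L_def R_def m_def l_def)
  next
    fix h assume "h \<in> set L \<union> set R"
    then have "coeffs_le ((B + 1) * C + (B + 1)) h"
      unfolding L_def R_def using coeffs_le_selector_forms[of m C G] coeff t u by blast
    \<comment> \<open>With \<open>m = length d + 1\<close>, the multiplier \<open>B + 1\<close> is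
      \<open>2 * length d + 5\<close>.\<close>
    then show "coeffs_le ((2 * int (length d) + 5) * (C + 1)) h"
      by (simp add: B_def m_def l_def algebra_simps)
  qed
qed

section \<open>Integer forms for exact threshold functions\<close>

text \<open>The cube is finite, so the nonzero values of \<open>v\<close> stay at distance
  \<open>\<delta>\<close> from 0. Dirichlet approximation yields an integer form within
  \<open>\<delta>\<close> of \<open>q * v\<close> for some integer \<open>q \<ge> 1\<close>. Where
  \<open>v\<close> vanishes, the form is an integer of absolute value below 1, hence 0; where the
  form vanishes, \<open>\<bar>v x\<bar> < \<delta>\<close>, hence \<open>v x = 0\<close>.\<close>

lemma same_zeros_exists:
  assumes w: "length w = n"
  shows "\<exists>f. same_zeros n (w, \<theta>) f"
proof -
  define X where "X = {x :: bool list. length x = n}"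
  define v where "v x = inner_prod w x - \<theta>" for x
  \<comment> \<open>The inserted 1 covers the case that \<open>v\<close> vanishes on the whole cube,
    and it ensures \<open>\<delta> \<le> 1\<close>.\<close>
  define \<delta> where "\<delta> = Min (insert 1 ((\<lambda>x. \<bar>v x\<bar>) ` {x \<in> X. v x \<noteq> 0}))"
  have fin: "finite X"
    using finite_lists_length_eq[of "UNIV :: bool set" n] by (simp add: X_def)
  have \<delta>: "0 < \<delta>" "\<delta> \<le> 1"
    using fin by (auto simp: \<delta>_def)
  have gap: "\<delta> \<le> \<bar>v x\<bar>" if "x \<in> X" "v x \<noteq> 0" for x
    using fin that by (auto simp: \<delta>_def intro!: Min_le)
  \<comment> \<open>The \<open>n\<close> weights and the threshold each contribute an error of at
    most \<open>1 / N\<close>.\<close>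
  obtain N :: nat where N: "real N > real (n + 1) / \<delta>"
    using reals_Archimedean2 by blast
  moreover have "real (n + 1) / \<delta> > 0"
    using \<delta> by simp
  ultimately have "N > 0"
    by (metis less_trans of_nat_0_less_iff)
  have small: "real (n + 1) / N < \<delta>"
    using N \<delta> \<open>N > 0\<close> by (simp add: field_simps)
  obtain q p where q: "0 < q"
    and qp: "\<And>i. i < n + 1 \<Longrightarrow>
          \<bar>of_int q * (if i < n then w ! i else \<theta>) - of_int (p i)\<bar> < 1 / real N"
    using Dirichlet_approx_simult[OF \<open>N > 0\<close>, of "n + 1" "\<lambda>i. if i < n then w ! i else \<theta>"]
    by blast
  define f :: affine_form where "f = (map p [0..<n], - p n)"
  have close: "\<bar>of_int q * v x - of_int (affine_eval f x)\<bar> < \<delta>" if "length x = n" for x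
  proof -
    have "of_int q * v x - of_int (affine_eval f x) =
        (\<Sum>i<n. (of_int q * w ! i - of_int (p i)) * of_bool (x ! i)) - (of_int q * \<theta> - of_int (p n))"
      using that
      by (simp add: v_def f_def Defs.inner_prod_def sum_distrib_left sum_subtractf algebra_simps
          del: sum_mult_of_bool_eq)
    also have "\<bar>\<dots>\<bar> \<le> (\<Sum>i<n. \<bar>(of_int q * w ! i - of_int (p i)) * of_bool (x ! i)\<bar>)
        + \<bar>of_int q * \<theta> - of_int (p n)\<bar>"
      by (rule order_trans[OF abs_triangle_ineq4 add_right_mono[OF sum_abs]])
    also have "\<dots> \<le> (\<Sum>i<n. 1 / real N) + 1 / real N"
    proof (rule add_mono[OF sum_mono])
      fix i assume "i \<in> {..<n}"
      then show "\<bar>(of_int q * w ! i - of_int (p i)) * of_bool (x ! i)\<bar> \<le> 1 / real N"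
        using qp[of i] by (cases "x ! i") auto
    qed (use qp[of n] in auto)
    also have "\<dots> = real (n + 1) / N"
      by (simp add: add_divide_distrib)
    finally show ?thesis
      using small by linarith
  qed
  have "v x = 0 \<longleftrightarrow> affine_eval f x = 0" if x: "length x = n" for x
  proof
    assume "v x = 0"
    then have "\<bar>real_of_int (affine_eval f x)\<bar> < 1"
      using close[OF x] \<delta> by simp
    then show "affine_eval f x = 0"
      by linarith
  next
    assume 0: "affine_eval f x = 0"
    have "\<bar>v x\<bar> \<le> of_int q * \<bar>v x\<bar>"
      using q mult_right_mono[of 1 "real_of_int q" "\<bar>v x\<bar>"] by simp
    also have "\<dots> < \<delta>"
      using close[OF x] 0 q by (simp add: abs_mult)
    finally show "v x = 0"
      using gap[of x] x by (force simp: X_def)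
  qed
  then show ?thesis
    by (intro exI[of _ f]) (auto simp: same_zeros_def v_def f_def)
qed

text \<open>The weights are already integers, and only the threshold may need replacing. The inner
  product is an integer in the range from \<open>- n * W\<close> to \<open>n * W\<close>, so a
  threshold that is not such an integer is never attained.\<close>

lemma same_zeros_exists_bounded:
  assumes w: "length w = n" "set w \<subseteq> \<int>" "\<And>a. a \<in> set w \<Longrightarrow> \<bar>a\<bar> \<le> real W"
  shows "\<exists>f. same_zeros n (w, \<theta>) f \<and> coeffs_le (int (n * W + W + 1)) f"
proof -
  define a where "a = map floor w"
  have a: "length a = n" "\<And>i. i < n \<Longrightarrow> w ! i = of_int (a ! i)"
    using w by (auto simp: a_def of_int_floor subset_iff)
  have a_le: "\<bar>c\<bar> \<le> int W" if c: "c \<in> set a" for c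
  proof -
    obtain i where i: "i < n" "c = a ! i"
      using c a(1) by (metis in_set_conv_nth)
    have "w ! i \<in> set w"
      using i(1) unfolding w(1)[symmetric] by (rule nth_mem)
    then have "\<bar>w ! i\<bar> \<le> real W"
      by (rule w(3))
    then have "\<bar>real_of_int c\<bar> \<le> real W"
      unfolding a(2)[OF i(1)] i(2) .
    then show ?thesis
      by linarith
  qed
  have eval: "inner_prod w x = of_int (inner_prod a x)" if "length x = n" for x
    using a that by (simp add: Defs.inner_prod_def)
  have bound: "\<bar>inner_prod a x\<bar> \<le> int (n * W)" if "length x = n" for x
  proof -
    have "\<bar>inner_prod a x\<bar> \<le> (\<Sum>i<n. \<bar>a ! i * of_bool (x ! i)\<bar>)"
      unfolding Defs.inner_prod_def that by (rule sum_abs)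
    also have "\<dots> \<le> (\<Sum>i<n. int W)"
      using a_le a(1) by (intro sum_mono) auto
    finally show ?thesis
      by simp
  qed
  \<comment> \<open>The value \<open>n * W + 1\<close> lies just outside the range of the inner
    product, so it too is never attained.\<close>
  define b where "b = (if \<theta> \<in> \<int> \<and> \<bar>\<theta>\<bar> \<le> real (n * W) then \<lfloor>\<theta>\<rfloor> else int (n * W + 1))"
  have "same_zeros n (w, \<theta>) (a, - b)"
    unfolding same_zeros_def
  proof (intro conjI allI impI)
    fix x :: "bool list" assume x: "length x = n"
    show "et_eval (w, \<theta>) x \<longleftrightarrow> affine_eval (a, - b) x = 0"
    proof (cases "\<theta> \<in> \<int> \<and> \<bar>\<theta>\<bar> \<le> real (n * W)")
      case True
      then have "\<theta> = of_int b"
        by (simp add: b_def of_int_floor)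
      then show ?thesis
        by (simp add: eval[OF x])
    next
      case False
      moreover have "\<bar>real_of_int (inner_prod a x)\<bar> \<le> real (n * W)"
        using bound[OF x] by linarith
      ultimately have "real_of_int (inner_prod a x) \<noteq> \<theta>"
        by auto
      moreover have "inner_prod a x \<noteq> b"
        using False bound[OF x] by (auto simp: b_def)
      ultimately show ?thesis
        by (simp add: eval[OF x])
    qed
  qed (use a in simp)
  moreover have "\<bar>b\<bar> \<le> int (n * W + 1)"
    unfolding b_def by (auto simp: abs_le_iff simp del: of_nat_mult) linarith+
  then have "coeffs_le (int (n * W + W + 1)) (a, - b)"
    using a_le by (force simp: coeffs_le_def)
  ultimately show ?thesis
    by blast
qed

text \<open>Finitely many coefficients have a maximum. For \<open>kSTAT\<close> any bound will do,
  since the size of the coefficients does not enter the class.\<close>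

lemma coeffs_le_exists:
  fixes l :: nat
  shows "\<exists>C \<ge> 0. \<forall>i < l. coeffs_le C (F i)"
proof -
  define S where "S = (\<Union>i<l. abs ` insert (snd (F i)) (set (fst (F i))))"
  have "finite S"
    by (simp add: S_def)
  then have "\<forall>i < l. coeffs_le (Max (insert 0 S)) (F i)"
    by (auto simp: coeffs_le_def S_def intro!: Max_ge)
  with \<open>finite S\<close> show ?thesis
    by (intro exI[of _ "Max (insert 0 S)"]) simp
qed

section \<open>The two inclusions\<close>

lemma eldl_rule:
  assumes "eldl_computes n d f" "i < length d"
  obtains w \<theta> c where "d ! i = ((w, \<theta>), c)" "length w = n" "((w, \<theta>), c) \<in> set d"
proof -
  obtain w \<theta> c where rule: "d ! i = ((w, \<theta>), c)"
    by (metis surj_pair)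
  with nth_mem[OF assms(2)] have "((w, \<theta>), c) \<in> set d"
    by simp
  moreover from this have "length w = n"
    using assms(1) by (auto simp: eldl_computes_def)
  ultimately show ?thesis
    using rule that by blast
qed

lemma ELDL_subset_kSTAT: "ELDL \<subseteq> kSTAT"
proof
  fix f assume "f \<in> ELDL"
  then obtain p :: "nat poly"
    where p: "\<And>n. \<exists>d. eldl_computes n d f \<and> length d \<le> poly p n"
    by (auto simp: ELDL_def)
  \<comment> \<open>Each side has two forms for each of the \<open>length d + 1\<close>
    tests.\<close>
  have "\<exists>L R kl kr. kstat_computes n L R kl kr f \<and> length L + length R \<le> poly (4 * (p + 1)) n" for n
  proof -
    obtain d where d: "eldl_computes n d f" "length d \<le> poly p n"
      using p by blast
    have "\<exists>h. same_zeros n (fst (d ! i)) h" if "i < length d" for i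
      using same_zeros_exists eldl_rule[OF d(1) that] by (metis fst_conv)
    then obtain F where F: "\<And>i. i < length d \<Longrightarrow> same_zeros n (fst (d ! i)) (F i)"
      by metis
    obtain C where "C \<ge> 0" "\<And>i. i < length d \<Longrightarrow> coeffs_le C (F i)"
      using coeffs_le_exists by blast
    then obtain L R k
      where "kstat_computes n L R k k f" "length L + length R = 4 * (length d + 1)"
      using kstat_computes_of_eldl[OF d(1) F] by metis
    with d(2) show ?thesis
      by (intro exI[of _ L] exI[of _ R] exI[of _ k]) simp
  qed
  then show "f \<in> kSTAT"
    unfolding kSTAT_def by blast
qed

lemma ELDL_poly_subset_kSTAT_poly: "ELDL_poly \<subseteq> kSTAT_poly"
proof
  fix f assume "f \<in> ELDL_poly"
  then obtain p q :: "nat poly"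
    where pq: "\<And>n. \<exists>d. eldl_computes n d f \<and> length d \<le> poly p n \<and>
        eldl_integral d \<and> eldl_max_weight d \<le> real (poly q n)"
    by (auto simp: ELDL_poly_def)
  \<comment> \<open>This is the bound \<open>(2 * length d + 5) * (C + 1)\<close> with
    \<open>C = n * W + W + 1\<close>, where \<open>p\<close> bounds the length, \<open>q\<close>
    gives \<open>W\<close>, and \<open>[:0, 1:]\<close> evaluates to \<open>n\<close>.\<close>
  define r where "r = (2 * p + 5) * ([:0, 1:] * q + q + 2)"
  have "\<exists>L R kl kr. kstat_computes n L R kl kr f \<and> length L + length R \<le> poly (4 * (p + 1)) n \<and>
      (\<forall>(a, b) \<in> set L \<union> set R. \<forall>c \<in> insert b (set a). \<bar>c\<bar> \<le> int (poly r n))" for n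
  proof -
    obtain d where d: "eldl_computes n d f" "length d \<le> poly p n" "eldl_integral d"
      "eldl_max_weight d \<le> real (poly q n)"
      using pq by blast
    define W where "W = poly q n"
    define C where "C = int (n * W + W + 1)"
    have "\<exists>h. same_zeros n (fst (d ! i)) h \<and> coeffs_le C h" if i: "i < length d" for i
    proof -
      obtain w \<theta> c where rule: "d ! i = ((w, \<theta>), c)" "length w = n" "((w, \<theta>), c) \<in> set d"
        using eldl_rule[OF d(1) i] by blast
      have "\<bar>a\<bar> \<le> real W" if "a \<in> set w" for a
      proof -
        have "\<bar>a\<bar> \<le> eldl_max_weight d"
          unfolding eldl_max_weight_def using rule(3) that by (intro Max_ge) force+
        with d(4) show ?thesis
          by (simp add: W_def)
      qed
      moreover have "set w \<subseteq> \<int>"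
        using d(3) rule(3) by (auto simp: eldl_integral_def)
      ultimately show ?thesis
        using same_zeros_exists_bounded[OF rule(2)] rule(1) by (simp add: C_def)
    qed
    then obtain F where F: "\<And>i. i < length d \<Longrightarrow> same_zeros n (fst (d ! i)) (F i)"
      "\<And>i. i < length d \<Longrightarrow> coeffs_le C (F i)"
      by metis
    have "C \<ge> 0"
      by (simp add: C_def)
    obtain L R k
      where LR: "kstat_computes n L R k k f" "length L + length R = 4 * (length d + 1)"
        "\<And>h. h \<in> set L \<union> set R \<Longrightarrow> coeffs_le ((2 * int (length d) + 5) * (C + 1)) h"
      using kstat_computes_of_eldl[OF d(1) F(1) \<open>C \<ge> 0\<close> F(2)] by metis
    have "(2 * int (length d) + 5) * (C + 1) \<le> (2 * int (poly p n) + 5) * (C + 1)"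
      using d(2) \<open>C \<ge> 0\<close> by (intro mult_right_mono) auto
    also have "\<dots> = int (poly r n)"
      by (simp add: r_def C_def W_def algebra_simps)
    finally have "\<forall>(a, b) \<in> set L \<union> set R. \<forall>c \<in> insert b (set a). \<bar>c\<bar> \<le> int (poly r n)"
      using LR(3) unfolding coeffs_le_def by fastforce
    with d(2) LR(1,2) show ?thesis
      by (intro exI[of _ L] exI[of _ R] exI[of _ k]) simp
  qed
  then show "f \<in> kSTAT_poly"
    unfolding kSTAT_poly_def by blast
qed

theorem theorem8: "ELDL \<subseteq> kSTAT \<and> ELDL_poly \<subseteq> kSTAT_poly"
  using ELDL_subset_kSTAT ELDL_poly_subset_kSTAT_poly by blast

end
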